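(* The incidence matrix of a $(v,k,1)$-BIBD forms a $\left(K=v,\;F=\frac{v(v-1)}{k(k-1)},\;(1-\frac{M}{N})=\frac{k}{v}\right)$-caching matrix. Further, there is a transmission scheme (for the caching scheme defined by this matrix) with rate $R=\frac{k(k-1)}{v-1}$.
   Context: A design is a pair $(\mathcal{X},\mathcal{A})$ with $\mathcal{X}$ a set of points and $\mathcal{A}$ a collection (multiset) of nonempty subsets of $\mathcal{X}$ called blocks. A $(v,k,1)$-BIBD, where $v>k\geq 2$, is a design with $|\mathcal{X}|=v$, each block having exactly $k$ points, and every pair of distinct points contained in exactly one block. The incidence matrix has rows indexed by the points, columns indexed by the blocks, and entry $1$ if the point lies in the block and $0$ otherwise. Coded caching model: a server holds $N$ files $W_1,\dots,W_N$ of equal size and is connected by an error-free broadcast link to $K$ users indexed by $\mathcal{U}$, $|\mathcal{U}|=K$. Each file $W_i$ is split into $F$ subfiles $W_{i,f}$, $f\in\mathcal{F}$, $|\mathcal{F}|=F$, of the same size and taking values in an abelian group. After the caches are filled, each user $u$ demands a file $W_{d_u}$, $d_u\in[N]$. The server broadcasts transmissions, each a linear combination (sum) of subfiles of demanded files; a transmission scheme is valid if, for all demands, every user $u$ can recover all subfiles of $W_{d_u}$ from its cache and the transmissions. The rate is $R=\frac{\text{number of transmissions}}{F}$. Caching matrix: a binary matrix $C$ with rows indexed by a $K$-set $\mathcal{U}$ and columns by an $F$-set $\mathcal{F}$, with the same number $Z$ of $1$'s in every row. It defines the caching scheme in which user $u$ caches $W_{i,f}$ for all $i\in[N]$ if $C(u,f)=0$,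 and does not cache it if $C(u,f)=1$; the uncached fraction is $1-\frac{M}{N}=\frac{Z}{F}$. $C$ is then called a $(K,F,(1-\frac{M}{N}))$-caching matrix. *)

theory Defs
  imports Complex_Main "HOL-Library.Multiset" "HOL-Library.FuncSet"
begin

definition design :: "'a set \<Rightarrow> 'a set multiset \<Rightarrow> bool" where
  "design X A \<longleftrightarrow> (\<forall>B \<in># A. B \<subseteq> X \<and> B \<noteq> {})"

text \<open>\<open>bibd1 v k X A\<close>: \<open>(X, A)\<close> is a \<open>(v, k, 1)\<close>-BIBD. Blocks are counted with
  multiplicity. Finiteness of \<open>X\<close> follows from \<open>card X = v > 0\<close>.\<close>

definition bibd1 :: "nat \<Rightarrow> nat \<Rightarrow> 'a set \<Rightarrow> 'a set multiset \<Rightarrow> bool" where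
  "bibd1 v k X A \<longleftrightarrow>
     design X A \<and> v > k \<and> k \<ge> 2 \<and> card X = v \<and>
     (\<forall>B \<in># A. card B = k) \<and>
     (\<forall>x \<in> X. \<forall>y \<in> X. x \<noteq> y \<longrightarrow> size {#B \<in># A. x \<in> B \<and> y \<in> B#} = 1)"

text \<open>Matrices are functions of a row index and a column index, considered on explicit index
  sets. The blocks form a multiset, so a column of the incidence matrix is indexed by a
  block together with the number of the copy.\<close>

definition block_index :: "'a set multiset \<Rightarrow> ('a set \<times> nat) set" where
  "block_index A = {(B, j). j < count A B}"

definition incidence_matrix :: "'a \<Rightarrow> 'a set \<times> nat \<Rightarrow> nat" where
  "incidence_matrix x b = (if x \<in> fst b then 1 else 0)"

text \<open>\<open>caching_matrix U Fs C K F q\<close>: on rows \<open>U\<close> and columns \<open>Fs\<close>, \<open>C\<close> is a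
  \<open>(K, F, q)\<close>-caching matrix, where \<open>q = Z / F\<close> is the uncached fraction \<open>1 - M / N\<close>.\<close>

definition caching_matrix ::
    "'u set \<Rightarrow> 'f set \<Rightarrow> ('u \<Rightarrow> 'f \<Rightarrow> nat) \<Rightarrow> nat \<Rightarrow> nat \<Rightarrow> real \<Rightarrow> bool" where
  "caching_matrix U Fs C K F q \<longleftrightarrow>
     finite U \<and> card U = K \<and> finite Fs \<and> card Fs = F \<and>
     (\<forall>u \<in> U. \<forall>f \<in> Fs. C u f \<in> {0, 1}) \<and>
     (\<exists>Z. (\<forall>u \<in> U. card {f \<in> Fs. C u f = 1} = Z) \<and> q = real Z / real F)"

text \<open>Files are numbered \<open>1, \<dots>, N\<close>, and \<open>W i f\<close> is the subfile \<open>f\<close> of file \<open>i\<close>.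
  The cache content is a function restricted to the cached positions, so it carries no
  information about the other subfiles.\<close>

definition cached_positions :: "'f set \<Rightarrow> ('u \<Rightarrow> 'f \<Rightarrow> nat) \<Rightarrow> nat \<Rightarrow> 'u \<Rightarrow> (nat \<times> 'f) set" where
  "cached_positions Fs C N u = {1..N} \<times> {f \<in> Fs. C u f = 0}"

definition cache_content ::
    "'f set \<Rightarrow> ('u \<Rightarrow> 'f \<Rightarrow> nat) \<Rightarrow> nat \<Rightarrow> 'u \<Rightarrow> (nat \<Rightarrow> 'f \<Rightarrow> 'g) \<Rightarrow> nat \<times> 'f \<Rightarrow> 'g" where
  "cache_content Fs C N u W = restrict (\<lambda>(i, f). W i f) (cached_positions Fs C N u)"

text \<open>A transmission is given by the set of positions of the subfiles that are added up.\<close>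

definition transmission_value ::
    "(nat \<Rightarrow> 'f \<Rightarrow> 'g::ab_group_add) \<Rightarrow> (nat \<times> 'f) set \<Rightarrow> 'g" where
  "transmission_value W S = (\<Sum>(i, f) \<in> S. W i f)"

text \<open>\<open>transmission_scheme TYPE('g) U Fs C N T tr\<close>: for every demand vector \<open>d\<close>, the list
  \<open>tr d\<close> consists of \<open>T\<close> sums of subfiles of demanded files, from which, together with its
  cache, every user can decode all subfiles of its demanded file. The decoder may depend on
  the demands and the user, but not on the contents \<open>W\<close> of the files, whose subfiles are
  arbitrary elements of the abelian group \<open>'g\<close>.\<close>

definition transmission_scheme ::
    "'g::ab_group_add itself \<Rightarrow> 'u set \<Rightarrow> 'f set \<Rightarrow> ('u \<Rightarrow> 'f \<Rightarrow> nat) \<Rightarrow> nat \<Rightarrow> nat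
      \<Rightarrow> (('u \<Rightarrow> nat) \<Rightarrow> (nat \<times> 'f) set list) \<Rightarrow> bool" where
  "transmission_scheme _ U Fs C N T tr \<longleftrightarrow>
     (\<forall>d \<in> U \<rightarrow>\<^sub>E {1..N}.
        length (tr d) = T \<and>
        (\<forall>S \<in> set (tr d). finite S \<and> S \<subseteq> d ` U \<times> Fs) \<and>
        (\<forall>u \<in> U. \<exists>dec :: (nat \<times> 'f \<Rightarrow> 'g) \<Rightarrow> 'g list \<Rightarrow> 'f \<Rightarrow> 'g.
           \<forall>W. \<forall>f \<in> Fs.
             dec (cache_content Fs C N u W) (map (transmission_value W) (tr d)) f = W (d u) f))"

definition rate :: "nat \<Rightarrow> nat \<Rightarrow> real" where
  "rate T F = real T / real F"

end

(* Each user u misses the subfiles of the blocks through u. Choose for every block B a fixed-point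
   free permutation s_B of B, which exists since k >= 2. For every point x send
   the sum over the blocks B through x of W_{d(s_B x), B}. Two blocks through x meet only in x, and
   s_B x differs from x, so the user s_B x misses exactly one summand, the one indexed by B. Since
   s_B is onto B, every flag (u, B) is served by some x, and v transmissions suffice. *)

theory Submission
  imports Defs
begin

text \<open>Enumerate the set and shift cyclically; with at least two elements the shift moves every
  point.\<close>

lemma derangement_exists:
  assumes "finite B" "card B \<ge> 2"
  shows "\<exists>s. bij_betw s B B \<and> (\<forall>x \<in> B. s x \<noteq> x)"
proof -
  define n where "n = card B"
  obtain h where h: "bij_betw h {0..<n} B"
    using ex_bij_betw_nat_finite[OF assms(1)] unfolding n_def by blast
  \<comment> \<open>The cyclic successor on \<open>{0..<n}\<close>; for \<open>n = 1\<close> it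
    would fix 0. The permutation sought is its conjugate by the enumeration
    \<open>h\<close>.\<close>
  define c where "c i = (if Suc i = n then 0 else Suc i)" for i
  have n: "n \<ge> 2" using assms(2) by (simp add: n_def)
  have c: "bij_betw c {0..<n} {0..<n}"
    by (rule bij_betw_byWitness[where f' = "\<lambda>i. if i = 0 then n - 1 else i - 1"])
      (use n in \<open>auto simp: c_def\<close>)
  have c_neq: "c i \<noteq> i" if "i < n" for i
    using n that by (auto simp: c_def)
  define g where "g = the_inv_into {0..<n} h"
  have g: "bij_betw g B {0..<n}"
    unfolding g_def by (rule bij_betw_the_inv_into[OF h])
  have hg: "h (g x) = x" if "x \<in> B" for x
    using h that unfolding g_def by (metis bij_betw_def f_the_inv_into_f)
  have "bij_betw (h \<circ> (c \<circ> g)) B B"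
    using bij_betw_trans[OF bij_betw_trans[OF g c] h] .
  moreover have "(h \<circ> (c \<circ> g)) x \<noteq> x" if "x \<in> B" for x
  proof
    assume "(h \<circ> (c \<circ> g)) x = x"
    then have "h (c (g x)) = h (g x)" using hg[OF that] by simp
    moreover have "g x \<in> {0..<n}" using g that by (rule bij_betwE[rule_format])
    moreover from this have "c (g x) \<in> {0..<n}" using c by (metis bij_betwE)
    ultimately have "c (g x) = g x" using h by (meson bij_betw_def inj_onD)
    then show False using c_neq \<open>g x \<in> {0..<n}\<close> by simp
  qed
  ultimately show ?thesis by blast
qed

text \<open>If all other summands of a transmission are cached, subtracting them leaves the wanted
  subfile. This turns decodability into a condition on positions alone.\<close>

lemma decodable_if_missing_one:
  fixes ts :: "(nat \<times> 'f) set list"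
  assumes d: "i \<in> {1..N}"
    and missing: "\<And>f. f \<in> Fs \<Longrightarrow> C u f \<noteq> 0 \<Longrightarrow>
      \<exists>S \<in> set ts. finite S \<and> (i, f) \<in> S \<and> S - {(i, f)} \<subseteq> cached_positions Fs C N u"
  shows "\<exists>dec :: (nat \<times> 'f \<Rightarrow> 'g::ab_group_add) \<Rightarrow> 'g list \<Rightarrow> 'f \<Rightarrow> 'g.
    \<forall>W. \<forall>f \<in> Fs. dec (cache_content Fs C N u W) (map (transmission_value W) ts) f = W i f"
proof -
  let ?P = "\<lambda>f n. n < length ts \<and> finite (ts ! n) \<and> (i, f) \<in> ts ! n \<and>
      ts ! n - {(i, f)} \<subseteq> cached_positions Fs C N u"
  \<comment> \<open>The choice does not involve \<open>W\<close>, as a decoder requires. It picks a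
    list index because the decoder sees only the list of transmitted values.\<close>
  define m where "m f = (SOME n. ?P f n)" for f
  have m: "?P f (m f)" if f: "f \<in> Fs" "C u f \<noteq> 0" for f
  proof -
    obtain T where "T \<in> set ts" "finite T" "(i, f) \<in> T"
        "T - {(i, f)} \<subseteq> cached_positions Fs C N u"
      using missing[OF f] by blast
    moreover from this(1) obtain n where "n < length ts" "T = ts ! n"
      by (metis in_set_conv_nth)
    ultimately have "\<exists>n. ?P f n" by (intro exI[of _ n]) simp
    then show ?thesis unfolding m_def by (rule someI_ex)
  qed
  define dec :: "(nat \<times> 'f \<Rightarrow> 'g) \<Rightarrow> 'g list \<Rightarrow> 'f \<Rightarrow> 'g" where
    "dec c vs f = (if C u f = 0 then c (i, f) else vs ! m f - sum c (ts ! m f - {(i, f)}))"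
    for c vs f
  have "dec (cache_content Fs C N u W) (map (transmission_value W) ts) f = W i f"
    if f: "f \<in> Fs" for W f
  proof (cases "C u f = 0")
    case True
    then show ?thesis
      using d f by (simp add: dec_def cache_content_def cached_positions_def)
  next
    case False
    have m: "m f < length ts" "finite (ts ! m f)" "(i, f) \<in> ts ! m f"
        "ts ! m f - {(i, f)} \<subseteq> cached_positions Fs C N u"
      using m[OF f False] by blast+
    have "sum (cache_content Fs C N u W) (ts ! m f - {(i, f)}) =
        (\<Sum>(j, g) \<in> ts ! m f - {(i, f)}. W j g)"
      using m(4) by (intro sum.cong) (auto simp: cache_content_def)
    moreover have "transmission_value W (ts ! m f) =
        W i f + (\<Sum>(j, g) \<in> ts ! m f - {(i, f)}. W j g)"
      unfolding transmission_value_def by (subst sum.remove[OF m(2,3)]) simp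
    ultimately show ?thesis
      using False m(1) by (simp add: dec_def)
  qed
  then show ?thesis by blast
qed

lemma block_index_Sigma: "block_index A = (SIGMA B : set_mset A. {..<count A B})"
  by (auto simp: block_index_def simp flip: count_greater_zero_iff)

lemma finite_block_index: "finite (block_index A)"
  by (simp add: block_index_Sigma)

lemma card_block_index: "card (block_index A) = size A"
  by (simp add: block_index_Sigma size_multiset_overloaded_eq)

text \<open>Translates the counts with multiplicity in \<open>bibd1\<close> into cardinalities of
  sets of columns.\<close>

lemma block_index_filter: "{b \<in> block_index A. P (fst b)} = block_index (filter_mset P A)"
  by (auto simp: block_index_def split: if_splits)

locale bibd =
  fixes v k :: nat and X :: "'a set" and A :: "'a set multiset"
  assumes bibd: "bibd1 v k X A"
begin

lemma k_ge: "k \<ge> 2" and v_gt: "v > k" and card_X: "card X = v"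
  using bibd by (auto simp: bibd1_def)

lemma finite_X: "finite X"
  using card_X v_gt by (metis card.infinite not_less_zero)

lemma block:
  assumes "b \<in> block_index A"
  shows "fst b \<subseteq> X" "finite (fst b)" "card (fst b) = k"
proof -
  have "fst b \<in># A" using assms by (auto simp: block_index_Sigma)
  then show "fst b \<subseteq> X" "card (fst b) = k"
    using bibd by (auto simp: bibd1_def design_def)
  then show "finite (fst b)" using finite_X finite_subset by blast
qed

lemma card_blocks_pair:
  assumes "x \<in> X" "y \<in> X" "x \<noteq> y"
  shows "card {b \<in> block_index A. x \<in> fst b \<and> y \<in> fst b} = 1"
  using assms bibd block_index_filter[of A "\<lambda>B. x \<in> B \<and> y \<in> B"]
  by (simp add: bibd1_def card_block_index)

text \<open>Both columns lie in a set of cardinality 1. Since copies count separately, this also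
  rules out two copies of one block.\<close>

lemma blocks_pair_unique:
  assumes "x \<noteq> y" "b \<in> block_index A" "c \<in> block_index A"
    and "x \<in> fst b" "y \<in> fst b" "x \<in> fst c" "y \<in> fst c"
  shows "b = c"
proof -
  have "card {b \<in> block_index A. x \<in> fst b \<and> y \<in> fst b} = 1"
    using assms(1,4,5) block(1)[OF assms(2)] by (intro card_blocks_pair) auto
  then obtain e where e: "{b \<in> block_index A. x \<in> fst b \<and> y \<in> fst b} = {e}"
    by (rule card_1_singletonE)
  have "b \<in> {e}" "c \<in> {e}"
    unfolding e[symmetric] using assms by simp_all
  then show ?thesis by simp
qed

text \<open>Double counting of the pairs of a block through \<open>x\<close> and a further point
  \<open>y\<close> on it: each such block has \<open>k - 1\<close> further points, and each
  \<open>y\<close> shares exactly one block with \<open>x\<close>.\<close>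

lemma replication:
  assumes "x \<in> X"
  shows "card {b \<in> block_index A. x \<in> fst b} * (k - 1) = v - 1"
proof -
  let ?D = "{b \<in> block_index A. x \<in> fst b}"
  have "(\<Sum>b \<in> ?D. card {y \<in> X - {x}. y \<in> fst b}) = 1 * card (X - {x})"
  proof (rule sum_multicount)
    show "\<forall>y \<in> X - {x}. card {b \<in> ?D. y \<in> fst b} = 1"
    proof
      fix y assume "y \<in> X - {x}"
      then show "card {b \<in> ?D. y \<in> fst b} = 1"
        using card_blocks_pair[OF assms, of y] by (auto simp: conj_assoc)
    qed
  qed (auto simp: finite_block_index finite_X)
  moreover have "card {y \<in> X - {x}. y \<in> fst b} = k - 1" if "b \<in> ?D" for b
  proof -
    have "{y \<in> X - {x}. y \<in> fst b} = fst b - {x}" using that block(1)[of b] by blast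
    then show ?thesis using that block(2,3)[of b] by simp
  qed
  ultimately show ?thesis
    using assms by (simp add: card_X)
qed

text \<open>The replication number of the design; the division is exact by
  \<open>r_times\<close>.\<close>

definition r where "r = (v - 1) div (k - 1)"

lemma card_blocks_point:
  assumes "x \<in> X"
  shows "card {b \<in> block_index A. x \<in> fst b} = r"
  using replication[OF assms] k_ge unfolding r_def
  by (metis Suc_1 Suc_le_eq nonzero_mult_div_cancel_right not_less_iff_gr_or_eq zero_less_diff)

lemma r_times: "r * (k - 1) = v - 1"
proof -
  have "X \<noteq> {}" using card_X v_gt by auto
  then obtain x where "x \<in> X" by blast
  then show ?thesis using replication card_blocks_point by simp
qed

text \<open>Double counting of the flags, that is, the pairs of a point and a block copy containing
  it.\<close>

lemma size_times_k: "size A * k = r * v"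
proof -
  have "(\<Sum>b \<in> block_index A. card {x \<in> X. x \<in> fst b}) = r * card X"
    by (rule sum_multicount) (auto simp: finite_block_index finite_X card_blocks_point)
  moreover have "{x \<in> X. x \<in> fst b} = fst b" if "b \<in> block_index A" for b
    using block(1)[OF that] by auto
  ultimately show ?thesis
    by (simp add: block(3) card_X card_block_index)
qed

lemma r_real: "real r * (real k - 1) = real v - 1"
  using arg_cong[OF r_times, of real] k_ge v_gt by (simp add: of_nat_diff)

lemma size_real: "real (size A) * real k = real r * real v"
  using arg_cong[OF size_times_k, of real] by simp

lemma size_eq: "real (size A) = real v * (real v - 1) / (real k * (real k - 1))"
  \<comment> \<open>Eliminates \<open>r\<close> from the two counting identities;
    \<open>k \<ge> 2\<close> keeps the denominator nonzero.\<close>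
  using k_ge size_real r_real by (simp add: field_simps) algebra

lemma caching_matrix_bibd:
  "caching_matrix X (block_index A) incidence_matrix v (size A) (real k / real v)"
proof -
  have "{f \<in> block_index A. incidence_matrix u f = 1} = {b \<in> block_index A. u \<in> fst b}" for u
    by (auto simp: incidence_matrix_def)
  \<comment> \<open>Every row has \<open>Z = r\<close> ones, so the uncached fraction is
    \<open>r / size A\<close>; the flag count turns it into \<open>k / v\<close>.\<close>
  moreover have "real k / real v = real r / real (size A)"
  proof -
    have "size A \<noteq> 0" using size_eq k_ge v_gt by auto
    then show ?thesis using size_real v_gt by (simp add: field_simps)
  qed
  ultimately show ?thesis
    unfolding caching_matrix_def
    using finite_X card_X card_blocks_point
    by (auto simp: finite_block_index card_block_index incidence_matrix_def)
qed

lemma transmission_scheme_bibd: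
  "\<exists>tr. transmission_scheme TYPE('g::ab_group_add) X (block_index A) incidence_matrix N v tr"
proof -
  let ?I = "block_index A"
  have "\<exists>s. bij_betw s (fst b) (fst b) \<and> (\<forall>x \<in> fst b. s x \<noteq> x)" if "b \<in> ?I" for b
    using derangement_exists[OF block(2)[OF that]] block(3)[OF that] k_ge by simp
  then obtain s where s_bij: "bij_betw (s b) (fst b) (fst b)" and s_neq: "\<forall>x \<in> fst b. s b x \<noteq> x"
    if "b \<in> ?I" for b by metis
  have s_in: "s b x \<in> fst b" if "b \<in> ?I" "x \<in> fst b" for b x
    using s_bij that by (metis bij_betwE)
  obtain xs where xs: "set xs = X" "length xs = v"
    using finite_distinct_list[OF finite_X] card_X distinct_card by metis
  \<comment> \<open>The second component keeps the summands distinct even when several users demand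
    the same file.\<close>
  define S where "S d x = (\<lambda>b. (d (s b x), b)) ` {b \<in> ?I. x \<in> fst b}" for d :: "'a \<Rightarrow> nat" and x
  define tr where "tr d = map (S d) xs" for d
  have finite_S: "finite (S d x)" for d x
    by (simp add: S_def finite_block_index)
  have S_subset: "S d x \<subseteq> d ` X \<times> ?I" for d x
    using s_in block(1) by (fastforce simp: S_def)
  have serve: "\<exists>P \<in> set (tr d). finite P \<and> (d u, b) \<in> P \<and>
      P - {(d u, b)} \<subseteq> cached_positions ?I incidence_matrix N u"
    if d: "d \<in> X \<rightarrow>\<^sub>E {1..N}" and u: "u \<in> X" and b: "b \<in> ?I" and missing: "incidence_matrix u b \<noteq> 0"
    for d u b
  proof -
    have ub: "u \<in> fst b" using missing by (simp add: incidence_matrix_def split: if_splits)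
    \<comment> \<open>The preimage of \<open>u\<close> under the permutation of \<open>b\<close>
      names the transmission that delivers column \<open>b\<close> to \<open>u\<close>.\<close>
    obtain x where x: "x \<in> fst b" "s b x = u"
      using s_bij[OF b] ub by (metis bij_betw_def imageE)
    have "x \<noteq> u" using s_neq[OF b] x by auto
    have "S d x - {(d u, b)} \<subseteq> cached_positions ?I incidence_matrix N u"
    proof
      fix p assume p: "p \<in> S d x - {(d u, b)}"
      then obtain c where c: "c \<in> ?I" "x \<in> fst c" "p = (d (s c x), c)" by (auto simp: S_def)
      \<comment> \<open>The only element of \<open>S d x\<close> with column \<open>b\<close> is
        \<open>(d u, b)\<close>, which has been removed.\<close>
      have "c \<noteq> b" using p c x by auto
      \<comment> \<open>Otherwise \<open>b\<close> and \<open>c\<close> would share the two distinct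
        points \<open>x\<close> and \<open>u\<close>.\<close>
      then have "u \<notin> fst c"
        using blocks_pair_unique[OF \<open>x \<noteq> u\<close> c(1) b] c(2) x ub by blast
      moreover have "d (s c x) \<in> {1..N}"
        using d s_in[OF c(1,2)] block(1)[OF c(1)] by blast
      ultimately show "p \<in> cached_positions ?I incidence_matrix N u"
        using c by (simp add: cached_positions_def incidence_matrix_def)
    qed
    moreover have "(d u, b) \<in> S d x" using b x by (auto simp: S_def)
    moreover have "S d x \<in> set (tr d)" using x block(1)[OF b] xs by (auto simp: tr_def)
    ultimately show ?thesis using finite_S by blast
  qed
  have tr: "length (tr d) = v" "\<forall>P \<in> set (tr d). finite P \<and> P \<subseteq> d ` X \<times> ?I" for d
    using xs finite_S S_subset by (simp_all add: tr_def)
  have "transmission_scheme TYPE('g) X ?I incidence_matrix N v tr"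
    unfolding transmission_scheme_def
  proof (intro ballI conjI)
    fix d u assume "d \<in> X \<rightarrow>\<^sub>E {1..N}" "u \<in> X"
    then show "\<exists>dec :: (nat \<times> 'a set \<times> nat \<Rightarrow> 'g) \<Rightarrow> 'g list \<Rightarrow> 'a set \<times> nat \<Rightarrow> 'g.
        \<forall>W. \<forall>f \<in> ?I. dec (cache_content ?I incidence_matrix N u W)
          (map (transmission_value W) (tr d)) f = W (d u) f"
      by (intro decodable_if_missing_one serve) auto
  qed (use tr in blast)+
  then show ?thesis by blast
qed

lemma rate_bibd: "rate v (size A) = real k * (real k - 1) / (real v - 1)"
  using k_ge v_gt by (simp add: rate_def size_eq)

end

theorem theorem2:
  fixes X :: "'a set" and A :: "'a set multiset" and v k N :: nat
  assumes "bibd1 v k X A"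
  shows "\<exists>F :: nat.
      real F = real v * (real v - 1) / (real k * (real k - 1)) \<and>
      caching_matrix X (block_index A) incidence_matrix v F (real k / real v) \<and>
      (\<exists>T tr. transmission_scheme TYPE('g::ab_group_add) X (block_index A) incidence_matrix N T tr \<and>
              rate T F = real k * (real k - 1) / (real v - 1))"
proof -
  interpret bibd v k X A by unfold_locales fact
  show ?thesis
    \<comment> \<open>The witnesses are \<open>F = size A\<close>, the number of blocks with
      multiplicity, and \<open>T = v\<close>, one transmission per point.\<close>
    using size_eq caching_matrix_bibd transmission_scheme_bibd rate_bibd by blast
qed

end
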